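(* Let $\mathbb{A}$ and $\mathbb{B}$ be finite categories with Möbius inversion. Let $F: \mathbb{A} \to \mathbb{B}$ and $G: \mathbb{B} \to \mathbb{A}$ be functors with $F$ left adjoint to $G$. Then for all $a \in \mathbb{A}$ and $b \in \mathbb{B}$, $$\sum_{a' \in \mathbb{A}:\, Fa' = b} \mu_{\mathbb{A}}(a, a') = \sum_{b' \in \mathbb{B}:\, Gb' = a} \mu_{\mathbb{B}}(b', b).$$
   Context: For a finite category $\mathbb{A}$, let $R(\mathbb{A})$ be the $\mathbb{Q}$-algebra of functions $\mathrm{ob}\,\mathbb{A} \times \mathrm{ob}\,\mathbb{A} \to \mathbb{Q}$ with pointwise addition and scalar multiplication, multiplication $(\theta\phi)(a,c) = \sum_{b} \theta(a,b)\phi(b,c)$, and unit the Kronecker $\delta$. The zeta function $\zeta_{\mathbb{A}} \in R(\mathbb{A})$ is $\zeta_{\mathbb{A}}(a,b) = |\mathbb{A}(a,b)|$. The category $\mathbb{A}$ has Möbius inversion if $\zeta_{\mathbb{A}}$ is invertible in $R(\mathbb{A})$; its inverse $\mu_{\mathbb{A}} = \zeta_{\mathbb{A}}^{-1}$ is the Möbius function of $\mathbb{A}$. *)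

theory Defs
  imports Complex_Main "HOL-Algebra.Module"
begin

record ('o, 'm) cat =
  Ob :: "'o set"
  Ar :: "'m set"
  Dom :: "'m \<Rightarrow> 'o"
  Cod :: "'m \<Rightarrow> 'o"
  Idt :: "'o \<Rightarrow> 'm"
  Cmp :: "'m \<Rightarrow> 'm \<Rightarrow> 'm"  (* Cmp A g f is "g after f" *)

definition Hom :: "('o, 'm) cat \<Rightarrow> 'o \<Rightarrow> 'o \<Rightarrow> 'm set" where
  "Hom A a b = {f \<in> Ar A. Dom A f = a \<and> Cod A f = b}"

locale category =
  fixes A :: "('o, 'm) cat"
  assumes Dom_closed: "f \<in> Ar A \<Longrightarrow> Dom A f \<in> Ob A"
    and Cod_closed: "f \<in> Ar A \<Longrightarrow> Cod A f \<in> Ob A"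
    and Idt_Hom: "a \<in> Ob A \<Longrightarrow> Idt A a \<in> Hom A a a"
    and Cmp_Hom: "\<lbrakk>f \<in> Hom A a b; g \<in> Hom A b c\<rbrakk> \<Longrightarrow> Cmp A g f \<in> Hom A a c"
    and Cmp_Idt_right: "f \<in> Hom A a b \<Longrightarrow> Cmp A f (Idt A a) = f"
    and Cmp_Idt_left: "f \<in> Hom A a b \<Longrightarrow> Cmp A (Idt A b) f = f"
    and Cmp_assoc: "\<lbrakk>f \<in> Hom A a b; g \<in> Hom A b c; h \<in> Hom A c d\<rbrakk>
      \<Longrightarrow> Cmp A h (Cmp A g f) = Cmp A (Cmp A h g) f"

locale finite_category = category +
  assumes finite_Ob: "finite (Ob A)"
    and finite_Ar: "finite (Ar A)"

record ('o1, 'm1, 'o2, 'm2) func =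
  ob_map :: "'o1 \<Rightarrow> 'o2"
  ar_map :: "'m1 \<Rightarrow> 'm2"

locale cat_functor = source: category A + target: category B
  for A :: "('o1, 'm1) cat" and B :: "('o2, 'm2) cat" +
  fixes F :: "('o1, 'm1, 'o2, 'm2) func"
  assumes ob_map_closed: "a \<in> Ob A \<Longrightarrow> ob_map F a \<in> Ob B"
    and ar_map_Hom: "f \<in> Hom A a a' \<Longrightarrow> ar_map F f \<in> Hom B (ob_map F a) (ob_map F a')"
    and ar_map_Idt: "a \<in> Ob A \<Longrightarrow> ar_map F (Idt A a) = Idt B (ob_map F a)"
    and ar_map_Cmp: "\<lbrakk>f \<in> Hom A a b; g \<in> Hom A b c\<rbrakk>
      \<Longrightarrow> ar_map F (Cmp A g f) = Cmp B (ar_map F g) (ar_map F f)"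

(* F is left adjoint to G: there are bijections B(F a, b) \<rightarrow> A(a, G b), natural in a and b. *)
definition left_adjoint ::
  "('o1, 'm1) cat \<Rightarrow> ('o2, 'm2) cat \<Rightarrow> ('o1, 'm1, 'o2, 'm2) func \<Rightarrow> ('o2, 'm2, 'o1, 'm1) func \<Rightarrow> bool"
  where
  "left_adjoint A B F G \<longleftrightarrow> (\<exists>\<phi>.
     (\<forall>a\<in>Ob A. \<forall>b\<in>Ob B. bij_betw (\<phi> a b) (Hom B (ob_map F a) b) (Hom A a (ob_map G b))) \<and>
     (\<forall>a\<in>Ob A. \<forall>a'\<in>Ob A. \<forall>b\<in>Ob B. \<forall>b'\<in>Ob B.
        \<forall>p\<in>Hom A a' a. \<forall>q\<in>Hom B b b'. \<forall>g\<in>Hom B (ob_map F a) b.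
          \<phi> a' b' (Cmp B q (Cmp B g (ar_map F p))) = Cmp A (ar_map G q) (Cmp A (\<phi> a b g) p)))"

(* The rational algebra R(A). Its elements are functions on Ob A \<times> Ob A, encoded as extensional
   functions, i.e. with the value undefined outside that set. *)
definition incidence_algebra :: "('o, 'm) cat \<Rightarrow> (rat, 'o \<times> 'o \<Rightarrow> rat) module" where
  "incidence_algebra A = \<lparr>
     carrier = Ob A \<times> Ob A \<rightarrow>\<^sub>E UNIV,
     monoid.mult = (\<lambda>\<theta> \<phi>. \<lambda>(a, c)\<in>Ob A \<times> Ob A. \<Sum>b\<in>Ob A. \<theta> (a, b) * \<phi> (b, c)),
     one = (\<lambda>(a, b)\<in>Ob A \<times> Ob A. if a = b then 1 else 0),
     zero = (\<lambda>p\<in>Ob A \<times> Ob A. 0),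
     add = (\<lambda>\<theta> \<phi>. \<lambda>p\<in>Ob A \<times> Ob A. \<theta> p + \<phi> p),
     smult = (\<lambda>r \<theta>. \<lambda>p\<in>Ob A \<times> Ob A. r * \<theta> p)\<rparr>"

definition zeta :: "('o, 'm) cat \<Rightarrow> 'o \<times> 'o \<Rightarrow> rat" where
  "zeta A = (\<lambda>(a, b)\<in>Ob A \<times> Ob A. of_nat (card (Hom A a b)))"

definition has_moebius_inversion :: "('o, 'm) cat \<Rightarrow> bool" where
  "has_moebius_inversion A \<longleftrightarrow> zeta A \<in> Units (incidence_algebra A)"

definition moebius :: "('o, 'm) cat \<Rightarrow> 'o \<times> 'o \<Rightarrow> rat" where
  "moebius A = inv\<^bsub>incidence_algebra A\<^esub> (zeta A)"

lemma incidence_algebra_ring: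
  assumes fin: "finite (Ob A)"
  shows "ring (incidence_algebra A)"
proof (intro ringI abelian_groupI monoidI)
  let ?R = "incidence_algebra A"
  note defs = incidence_algebra_def
  fix x y z assume x: "x \<in> carrier ?R" and y: "y \<in> carrier ?R" and z: "z \<in> carrier ?R"
  show "x \<otimes>\<^bsub>?R\<^esub> y \<otimes>\<^bsub>?R\<^esub> z = x \<otimes>\<^bsub>?R\<^esub> (y \<otimes>\<^bsub>?R\<^esub> z)"
  proof
    fix p :: "'a \<times> 'a"
    obtain a c where p: "p = (a, c)" by (cases p)
    have "(\<Sum>b\<in>Ob A. (\<Sum>d\<in>Ob A. x (a, d) * y (d, b)) * z (b, c)) =
          (\<Sum>b\<in>Ob A. x (a, b) * (\<Sum>d\<in>Ob A. y (b, d) * z (d, c)))"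
      by (simp add: sum_distrib_left sum_distrib_right mult.assoc)
         (rule sum.swap)
    then show "(x \<otimes>\<^bsub>?R\<^esub> y \<otimes>\<^bsub>?R\<^esub> z) p = (x \<otimes>\<^bsub>?R\<^esub> (y \<otimes>\<^bsub>?R\<^esub> z)) p"
      by (simp add: defs p)
  qed
  show "(x \<oplus>\<^bsub>?R\<^esub> y) \<otimes>\<^bsub>?R\<^esub> z = x \<otimes>\<^bsub>?R\<^esub> z \<oplus>\<^bsub>?R\<^esub> y \<otimes>\<^bsub>?R\<^esub> z"
    by (rule ext) (simp add: defs restrict_def distrib_right sum.distrib split: prod.split)
  show "z \<otimes>\<^bsub>?R\<^esub> (x \<oplus>\<^bsub>?R\<^esub> y) = z \<otimes>\<^bsub>?R\<^esub> x \<oplus>\<^bsub>?R\<^esub> z \<otimes>\<^bsub>?R\<^esub> y"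
    by (rule ext) (simp add: defs restrict_def distrib_left sum.distrib split: prod.split)
  show "x \<oplus>\<^bsub>?R\<^esub> y \<oplus>\<^bsub>?R\<^esub> z = x \<oplus>\<^bsub>?R\<^esub> (y \<oplus>\<^bsub>?R\<^esub> z)"
    by (rule ext) (simp add: defs restrict_def)
next
  let ?R = "incidence_algebra A"
  fix x assume x: "x \<in> carrier ?R"
  then have ext: "x p = undefined" if "p \<notin> Ob A \<times> Ob A" for p
    using that by (cases p) (auto simp: incidence_algebra_def PiE_def extensional_def)
  have sg: "(if P then 1 else 0) * r = (if P then r else 0)"
           "r * (if P then 1 else 0) = (if P then r else 0)" for P and r :: rat
    by simp_all
  show "\<one>\<^bsub>?R\<^esub> \<otimes>\<^bsub>?R\<^esub> x = x"
    by (rule HOL.ext) (use fin in \<open>auto simp: incidence_algebra_def ext restrict_def sg\<close>)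
  show "x \<otimes>\<^bsub>?R\<^esub> \<one>\<^bsub>?R\<^esub> = x"
    by (rule HOL.ext) (use fin in \<open>auto simp: incidence_algebra_def ext restrict_def sg\<close>)
  show "\<zero>\<^bsub>?R\<^esub> \<oplus>\<^bsub>?R\<^esub> x = x"
    by (rule HOL.ext) (auto simp: incidence_algebra_def ext restrict_def)
  show "\<exists>y\<in>carrier ?R. y \<oplus>\<^bsub>?R\<^esub> x = \<zero>\<^bsub>?R\<^esub>"
    by (rule bexI[of _ "\<lambda>p\<in>Ob A \<times> Ob A. - x p"])
       (auto simp: incidence_algebra_def restrict_def split: if_splits)
qed (auto simp: incidence_algebra_def fun_eq_iff add.commute)

end

theory Submission
  imports Defs
begin

text \<open>Numerically, the adjunction says that \<open>|B(F a', b')| = |A(a', G b')|\<close> for all objects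
  \<open>a'\<close> and \<open>b'\<close> (\<open>left_adjoint_card_Hom\<close>). Both sides of the identity are evaluations of the
  double sum over \<open>a'\<close> and \<open>b'\<close> of \<open>\<mu>\<^sub>A(a, a') \<cdot> |B(F a', b')| \<cdot> \<mu>\<^sub>B(b', b)\<close>.
  Summing over \<open>b'\<close> first, \<open>\<zeta>\<^sub>B \<mu>\<^sub>B = \<delta>\<close> leaves the sum of \<open>\<mu>\<^sub>A(a, a')\<close> over those \<open>a'\<close> with
  \<open>F a' = b\<close>. After replacing the middle factor by \<open>|A(a', G b')|\<close> and summing over \<open>a'\<close>
  first, \<open>\<mu>\<^sub>A \<zeta>\<^sub>A = \<delta>\<close> leaves the sum of \<open>\<mu>\<^sub>B(b', b)\<close> over those \<open>b'\<close> with \<open>G b' = a\<close>.\<close>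

lemma moebius_zeta:
  assumes "finite (Ob A)" "has_moebius_inversion A" "a \<in> Ob A" "c \<in> Ob A"
  shows "(\<Sum>b\<in>Ob A. moebius A (a, b) * of_nat (card (Hom A b c))) = (if a = c then 1 else 0)"
proof -
  interpret ring "incidence_algebra A"
    using assms(1) by (rule incidence_algebra_ring)
  have "(moebius A \<otimes>\<^bsub>incidence_algebra A\<^esub> zeta A) (a, c) = \<one>\<^bsub>incidence_algebra A\<^esub> (a, c)"
    using assms(2) by (simp add: moebius_def has_moebius_inversion_def)
  then show ?thesis
    using assms(3,4) by (simp add: incidence_algebra_def zeta_def)
qed

lemma zeta_moebius:
  assumes "finite (Ob A)" "has_moebius_inversion A" "a \<in> Ob A" "c \<in> Ob A"
  shows "(\<Sum>b\<in>Ob A. of_nat (card (Hom A a b)) * moebius A (b, c)) = (if a = c then 1 else 0)"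
proof -
  interpret ring "incidence_algebra A"
    using assms(1) by (rule incidence_algebra_ring)
  have "(zeta A \<otimes>\<^bsub>incidence_algebra A\<^esub> moebius A) (a, c) = \<one>\<^bsub>incidence_algebra A\<^esub> (a, c)"
    using assms(2) by (simp add: moebius_def has_moebius_inversion_def)
  then show ?thesis
    using assms(3,4) by (simp add: incidence_algebra_def zeta_def)
qed

lemma left_adjoint_card_Hom:
  assumes "left_adjoint A B F G" "a \<in> Ob A" "b \<in> Ob B"
  shows "card (Hom B (ob_map F a) b) = card (Hom A a (ob_map G b))"
  using assms unfolding left_adjoint_def by (blast intro: bij_betw_same_card)

theorem proposition4p4:
  fixes A :: "('o1, 'm1) cat" and B :: "('o2, 'm2) cat"
    and F :: "('o1, 'm1, 'o2, 'm2) func" and G :: "('o2, 'm2, 'o1, 'm1) func"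
  assumes "finite_category A" and "finite_category B"
    and "has_moebius_inversion A" and "has_moebius_inversion B"
    and "cat_functor A B F" and "cat_functor B A G"
    and "left_adjoint A B F G"
    and "a \<in> Ob A" and "b \<in> Ob B"
  shows "(\<Sum>a' | a' \<in> Ob A \<and> ob_map F a' = b. moebius A (a, a'))
       = (\<Sum>b' | b' \<in> Ob B \<and> ob_map G b' = a. moebius B (b', b))"
proof -
  have finA: "finite (Ob A)" and finB: "finite (Ob B)"
    using assms(1,2) by (simp_all add: finite_category.finite_Ob)
  have F: "ob_map F a' \<in> Ob B" if "a' \<in> Ob A" for a'
    using assms(5) that by (rule cat_functor.ob_map_closed)
  have G: "ob_map G b' \<in> Ob A" if "b' \<in> Ob B" for b'
    using assms(6) that by (rule cat_functor.ob_map_closed)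
  have "(\<Sum>a' | a' \<in> Ob A \<and> ob_map F a' = b. moebius A (a, a'))
      = (\<Sum>a'\<in>Ob A. moebius A (a, a') * (if ob_map F a' = b then 1 else 0))"
    using finA by (simp add: sum.inter_filter if_distrib cong: if_cong)
  also have "\<dots> = (\<Sum>a'\<in>Ob A. moebius A (a, a') *
      (\<Sum>b'\<in>Ob B. of_nat (card (Hom B (ob_map F a') b')) * moebius B (b', b)))"
    using zeta_moebius[OF finB assms(4) F assms(9)] by simp
  also have "\<dots> = (\<Sum>a'\<in>Ob A. \<Sum>b'\<in>Ob B.
      moebius A (a, a') * of_nat (card (Hom A a' (ob_map G b'))) * moebius B (b', b))"
    by (simp add: left_adjoint_card_Hom[OF assms(7)] sum_distrib_left mult.assoc)
  also have "\<dots> = (\<Sum>b'\<in>Ob B.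
      (\<Sum>a'\<in>Ob A. moebius A (a, a') * of_nat (card (Hom A a' (ob_map G b')))) * moebius B (b', b))"
    by (subst sum.swap) (simp add: sum_distrib_right)
  also have "\<dots> = (\<Sum>b'\<in>Ob B. (if a = ob_map G b' then 1 else 0) * moebius B (b', b))"
    using moebius_zeta[OF finA assms(3,8) G] by simp
  also have "\<dots> = (\<Sum>b' | b' \<in> Ob B \<and> ob_map G b' = a. moebius B (b', b))"
    using finB by (simp add: sum.inter_filter if_distrib[of "\<lambda>x. x * _"] eq_commute[of a] cong: if_cong)
  finally show ?thesis .
qed

end
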